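(* Let $(\mathcal S,\mathcal A,\mu)$ be a $\sigma$-finite measure space, $p(s)\ge0$ a function with $\int_{\mathcal S}p(s)\,d\mu(s)=1$, and $P(A)=\int_Ap(s)\,d\mu(s)$, $A\in\mathcal A$. Let $f$ be a measurable function on $\mathcal S$ such that the integral $I=\int_{\mathcal S}f(s)p(s)\,d\mu(s)$ exists, and let $\xi=f(s)$ be regarded as a random variable on $(\mathcal S,\mathcal A,P)$, so that $I=E\xi$. Let $\xi_i$, $i=1,\dots,n$, be independent copies of $\xi$ and $Z_n=\frac1n\sum_{i=1}^n\xi_i$. If $\xi$ belongs to an Orlicz space $L_U(\Omega)$ that satisfies condition $\mathbf H$ with constant $C_U$, then $Z_n$ approximates $I$ with reliability $1-\delta$ ($0<\delta<1$) and accuracy $\varepsilon>0$, i.e. $P\{|Z_n-I|>\varepsilon\}\le\delta$, whenever $$n\ge\left(\frac{L\,U^{(-1)}(1/\delta)}{\varepsilon}\right)^2,\qquad L=\|\xi-I\|_U\sqrt{C_U}.$$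
   Context: A $C$-function $U$ is a continuous even convex function on $\mathbb R$, monotonically increasing for $x>0$, with $U(0)=0$; $U^{(-1)}$ is its inverse on $[0,\infty)$. $L_U(\Omega)$ is the family of random variables $\xi$ with $EU(\xi/r)<\infty$ for some $r>0$, with norm $\|\xi\|_U=\inf\{r>0:EU(\xi/r)\le1\}$. Condition $\mathbf H$ with constant $C_U$: for any centered independent $\xi_1,\dots,\xi_n\in L_U(\Omega)$, $\|\sum_{k=1}^n\xi_k\|_U^2\le C_U\sum_{k=1}^n\|\xi_k\|_U^2$. *)

theory Defs
  imports "HOL-Probability.Probability"
begin

text \<open>Increasing is read strictly, as is needed for \<open>U\<close> to have an inverse on \<open>[0, \<infinity>)\<close>.\<close>

definition C_function :: "(real \<Rightarrow> real) \<Rightarrow> bool" where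
  "C_function U \<longleftrightarrow>
     continuous_on UNIV U \<and> (\<forall>x. U (- x) = U x) \<and> convex_on UNIV U \<and>
     strict_mono_on {0<..} U \<and> U 0 = 0"

definition C_inverse :: "(real \<Rightarrow> real) \<Rightarrow> real \<Rightarrow> real" where
  "C_inverse U = the_inv_into {0..} U"

text \<open>
  \<open>U\<close> is nonnegative, so the expectation of \<open>U (X / r)\<close> is taken as a nonnegative integral
  with values in \<open>[0, \<infinity>]\<close>. The Bochner integral would assign the value \<open>0\<close> to a divergent
  expectation and so admit spurious \<open>r\<close> in the infimum defining the norm.
\<close>

definition orlicz_space :: "(real \<Rightarrow> real) \<Rightarrow> 'a measure \<Rightarrow> ('a \<Rightarrow> real) set" where
  "orlicz_space U M =
     {X \<in> borel_measurable M. \<exists>r>0. (\<integral>\<^sup>+\<omega>. ennreal (U (X \<omega> / r)) \<partial>M) < \<infinity>}"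

definition orlicz_norm :: "(real \<Rightarrow> real) \<Rightarrow> 'a measure \<Rightarrow> ('a \<Rightarrow> real) \<Rightarrow> real" where
  "orlicz_norm U M X = Inf {r. r > 0 \<and> (\<integral>\<^sup>+\<omega>. ennreal (U (X \<omega> / r)) \<partial>M) \<le> 1}"

definition condition_H :: "(real \<Rightarrow> real) \<Rightarrow> 'a measure \<Rightarrow> real \<Rightarrow> bool" where
  "condition_H U M C \<longleftrightarrow>
     (\<forall>(n::nat) (X :: nat \<Rightarrow> 'a \<Rightarrow> real).
        (\<forall>k\<in>{1..n}. X k \<in> orlicz_space U M \<and> integrable M (X k) \<and> (\<integral>\<omega>. X k \<omega> \<partial>M) = 0) \<longrightarrow>
        prob_space.indep_vars M (\<lambda>_. borel) X {1..n} \<longrightarrow>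
        (orlicz_norm U M (\<lambda>\<omega>. \<Sum>k=1..n. X k \<omega>))\<^sup>2 \<le> C * (\<Sum>k=1..n. (orlicz_norm U M (X k))\<^sup>2))"

end

theory Submission
  imports Defs
begin

text \<open>
  The bound is Chebyshev's inequality carried out with \<open>U\<close> in place of the square. If
  \<open>E U(X / R) \<le> 1\<close>, then \<open>\<bar>X\<bar> > a\<close> forces \<open>U (X / R) \<ge> U (a / R)\<close>, so Markov's inequality gives
  \<open>P(\<bar>X\<bar> > a) \<le> 1 / U (a / R)\<close>. Taking \<open>R\<close> down to the norm of \<open>X\<close> shows that
  \<open>P(\<bar>X\<bar> > a) \<le> 1 / U u\<close> as soon as \<open>\<parallel>X\<parallel>\<^sub>U u \<le> a\<close>; this is
  \<open>orlicz_chebyshev\<close>. It is applied to \<open>X = \<Sum>i\<le>n. (\<xi> i - I) = n (Z - I)\<close>, with \<open>a = n \<epsilon>\<close> and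
  \<open>u\<close> the inverse of \<open>U\<close> at \<open>1 / \<delta>\<close>.

  Independence enters through condition H alone: the summands are centered and share the norm of
  \<open>f - I\<close>, so the norm of their sum is at most \<open>\<surd>n L\<close>, whereas the triangle inequality alone
  would give a bound linear in \<open>n\<close>, useless against \<open>a = n \<epsilon>\<close>. The hypothesis on \<open>n\<close> is what
  makes \<open>\<surd>n L u \<le> n \<epsilon>\<close>.

  The infimum defining the norm carries information only if some \<open>r\<close> is admissible. For this reason
  the Orlicz space is shown to be closed under sums and to contain the constants.
\<close>

section \<open>Growth of C-functions\<close>

lemma C_function_strict_mono:
  assumes "C_function U"
  shows "strict_mono_on {0..} U"
proof (rule strict_mono_onI)
  fix x y :: real assume xy: "x \<in> {0..}" "y \<in> {0..}" "x < y"
  have mono: "\<And>x y. 0 < x \<Longrightarrow> x < y \<Longrightarrow> U x < U y"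
    using assms by (auto simp: C_function_def strict_mono_on_def)
  have nonneg: "0 \<le> U x" for x
  proof -
    have cv: "convex_on UNIV U" and ev: "U (-x) = U x" and z: "U 0 = 0"
      using assms by (auto simp: C_function_def)
    have "U ((1 - 1/2) *\<^sub>R x + (1/2) *\<^sub>R (-x)) \<le> (1 - 1/2) * U x + (1/2) * U (-x)"
      by (rule convex_onD[OF cv]) auto
    then show ?thesis using ev z by simp
  qed
  show "U x < U y"
  proof (cases "x = 0")
    case True
    \<comment> \<open>Monotonicity is only given on the open half-line, so the origin is reached through \<open>y / 2\<close>.\<close>
    have "U 0 = 0" using assms by (simp add: C_function_def)
    moreover have "U (y / 2) < U y" using True xy by (intro mono) auto
    ultimately show ?thesis using nonneg[of "y / 2"] True by simp
  next
    case False
    then show ?thesis using xy by (intro mono) auto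
  qed
qed

lemma C_function_mono_abs:
  assumes "C_function U" and "\<bar>x\<bar> \<le> \<bar>y\<bar>"
  shows "U x \<le> U y"
proof -
  have "U \<bar>z\<bar> = U z" for z using assms(1) by (auto simp: C_function_def abs_if)
  moreover have "U \<bar>x\<bar> \<le> U \<bar>y\<bar>"
    using strict_mono_on_leD[OF C_function_strict_mono[OF assms(1)], of "\<bar>x\<bar>" "\<bar>y\<bar>"] assms(2)
    by simp
  ultimately show ?thesis by simp
qed

lemma C_function_nonneg:
  assumes "C_function U"
  shows "0 \<le> U x"
  using C_function_mono_abs[OF assms, of 0 x] assms by (simp add: C_function_def)

lemma C_function_borel_measurable:
  assumes "C_function U"
  shows "U \<in> borel_measurable borel"
  using assms by (auto simp: C_function_def intro: borel_measurable_continuous_onI)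

lemma C_function_scale_le:
  assumes "C_function U" and "0 \<le> t" "t \<le> 1"
  shows "U (t * x) \<le> t * U x"
proof -
  have "convex_on UNIV U" "U 0 = 0" using assms(1) by (auto simp: C_function_def)
  then show ?thesis using convex_onD[of UNIV U t 0 x] assms(2,3) by simp
qed

text \<open>Convexity with \<open>U 0 = 0\<close> gives \<open>U x \<ge> x U 1\<close> for \<open>x \<ge> 1\<close>, so \<open>U\<close> is unbounded and the
  intermediate value theorem reaches every nonnegative \<open>y\<close>.\<close>

lemma C_function_surj:
  assumes "C_function U" and "0 \<le> y"
  shows "y \<in> U ` {0..}"
proof -
  have z: "U 0 = 0" and ct: "continuous_on UNIV U" using assms(1) by (auto simp: C_function_def)
  have pos: "0 < U 1"
    using strict_mono_onD[OF C_function_strict_mono[OF assms(1)], of 0 1] z by simp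
  define b where "b = max 1 (y / U 1)"
  have b: "1 \<le> b" "y / U 1 \<le> b" by (auto simp: b_def)
  have "U 1 \<le> (1 / b) * U b"
    using C_function_scale_le[OF assms(1), of "1 / b" b] b by simp
  then have "b * U 1 \<le> U b" using b by (simp add: field_simps)
  moreover have "y \<le> b * U 1" using b(2) pos by (simp add: field_simps)
  ultimately have "y \<le> U b" by simp
  then obtain x where "0 \<le> x" "x \<le> b" "U x = y"
    using IVT'[of U 0 y b] z assms(2) b(1) continuous_on_subset[OF ct] by auto
  then show ?thesis by auto
qed

lemma C_inverse:
  assumes "C_function U" and "0 \<le> y"
  shows "U (C_inverse U y) = y" and "0 \<le> C_inverse U y"
proof -
  have inj: "inj_on U {0..}"
    using C_function_strict_mono[OF assms(1)] by (rule strict_mono_on_imp_inj_on)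
  note im = C_function_surj[OF assms]
  show "U (C_inverse U y) = y"
    unfolding C_inverse_def by (rule f_the_inv_into_f[OF inj im])
  show "0 \<le> C_inverse U y"
    unfolding C_inverse_def using the_inv_into_into[OF inj im order_refl] by simp
qed

section \<open>Orlicz spaces\<close>

lemma orlicz_space_add:
  assumes U: "C_function U" and X: "X \<in> orlicz_space U M" and Y: "Y \<in> orlicz_space U M"
  shows "(\<lambda>\<omega>. X \<omega> + Y \<omega>) \<in> orlicz_space U M"
proof -
  have mX: "X \<in> borel_measurable M" and mY: "Y \<in> borel_measurable M"
    using X Y by (auto simp: orlicz_space_def)
  note [measurable] = mX mY C_function_borel_measurable[OF U]
  obtain r where r: "r > 0" "(\<integral>\<^sup>+\<omega>. ennreal (U (X \<omega> / r)) \<partial>M) < \<infinity>"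
    using X by (auto simp: orlicz_space_def)
  obtain q where q: "q > 0" "(\<integral>\<^sup>+\<omega>. ennreal (U (Y \<omega> / q)) \<partial>M) < \<infinity>"
    using Y by (auto simp: orlicz_space_def)
  have cv: "convex_on UNIV U" using U by (simp add: C_function_def)
  \<comment> \<open>\<open>(x + y) / (r + q)\<close> is the convex combination of \<open>x / r\<close> and \<open>y / q\<close> with weights
    \<open>r / (r + q)\<close> and \<open>q / (r + q)\<close>; the weights are then dropped, since \<open>U \<ge> 0\<close>.\<close>
  have le: "U ((x + y) / (r + q)) \<le> U (x / r) + U (y / q)" for x y
  proof -
    define t where "t = q / (r + q)"
    have t: "0 \<le> t" "t \<le> 1" using r(1) q(1) by (auto simp: t_def)
    have "(1 - t) * (x / r) = x / (r + q)" "t * (y / q) = y / (r + q)"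
      using r(1) q(1) by (auto simp: t_def field_simps)
    then have "(x + y) / (r + q) = (1 - t) *\<^sub>R (x / r) + t *\<^sub>R (y / q)"
      by (simp add: add_divide_distrib)
    also have "U \<dots> \<le> (1 - t) * U (x / r) + t * U (y / q)"
      by (rule convex_onD[OF cv]) (use t in auto)
    also have "\<dots> \<le> 1 * U (x / r) + 1 * U (y / q)"
      by (intro add_mono mult_right_mono) (use t C_function_nonneg[OF U] in auto)
    finally show ?thesis by simp
  qed
  have "(\<integral>\<^sup>+\<omega>. ennreal (U ((X \<omega> + Y \<omega>) / (r + q))) \<partial>M)
      \<le> (\<integral>\<^sup>+\<omega>. ennreal (U (X \<omega> / r)) + ennreal (U (Y \<omega> / q)) \<partial>M)"
    by (intro nn_integral_mono)
       (simp add: le C_function_nonneg[OF U] ennreal_leI flip: ennreal_plus)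
  also have "\<dots> = (\<integral>\<^sup>+\<omega>. ennreal (U (X \<omega> / r)) \<partial>M) + (\<integral>\<^sup>+\<omega>. ennreal (U (Y \<omega> / q)) \<partial>M)"
    by (rule nn_integral_add) auto
  also have "\<dots> < \<infinity>" using r(2) q(2) by (simp add: less_top)
  finally have "(\<integral>\<^sup>+\<omega>. ennreal (U ((X \<omega> + Y \<omega>) / (r + q))) \<partial>M) < \<infinity>" .
  moreover have "r + q > 0" using r(1) q(1) by simp
  ultimately show ?thesis unfolding orlicz_space_def by auto
qed

lemma (in finite_measure) orlicz_space_const:
  "(\<lambda>_. c) \<in> orlicz_space U M"
  by (auto simp: orlicz_space_def ennreal_mult_less_top emeasure_eq_measure intro!: exI[of _ 1])

lemma (in finite_measure) orlicz_space_sum: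
  assumes "C_function U" and "\<And>i. i \<in> A \<Longrightarrow> X i \<in> orlicz_space U M"
  shows "(\<lambda>\<omega>. \<Sum>i\<in>A. X i \<omega>) \<in> orlicz_space U M"
  using assms(2)
proof (induction A rule: infinite_finite_induct)
  case (insert i A)
  then show ?case by (simp add: orlicz_space_add[OF assms(1)])
qed (simp_all add: orlicz_space_const)

lemma orlicz_space_distr:
  assumes [measurable]: "X \<in> borel_measurable M" "g \<in> borel_measurable borel"
    and "C_function U"
  shows "g \<in> orlicz_space U (distr M borel X) \<longleftrightarrow> (\<lambda>\<omega>. g (X \<omega>)) \<in> orlicz_space U M"
  using C_function_borel_measurable[OF assms(3), measurable]
  by (simp add: orlicz_space_def nn_integral_distr)

lemma orlicz_norm_distr:
  assumes [measurable]: "X \<in> borel_measurable M" "g \<in> borel_measurable borel"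
    and "C_function U"
  shows "orlicz_norm U (distr M borel X) g = orlicz_norm U M (\<lambda>\<omega>. g (X \<omega>))"
  using C_function_borel_measurable[OF assms(3), measurable]
  by (simp add: orlicz_norm_def nn_integral_distr)

text \<open>Membership in the space only asks for a finite expectation of \<open>U (X / r)\<close>. Enlarging \<open>r\<close> by
  the factor \<open>t\<close> divides that expectation by at least \<open>t\<close>, so it can be brought below 1.\<close>

lemma orlicz_norm_set_nonempty:
  assumes U: "C_function U" and X: "X \<in> orlicz_space U M"
  shows "{r. r > 0 \<and> (\<integral>\<^sup>+\<omega>. ennreal (U (X \<omega> / r)) \<partial>M) \<le> 1} \<noteq> {}"
proof -
  have mX: "X \<in> borel_measurable M" using X by (simp add: orlicz_space_def)
  note [measurable] = mX C_function_borel_measurable[OF U]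
  obtain r where r: "r > 0" "(\<integral>\<^sup>+\<omega>. ennreal (U (X \<omega> / r)) \<partial>M) < \<infinity>"
    using X by (auto simp: orlicz_space_def)
  obtain e where e: "(\<integral>\<^sup>+\<omega>. ennreal (U (X \<omega> / r)) \<partial>M) = ennreal e" "0 \<le> e"
    using r(2) by (metis ennreal_cases infinity_ennreal_def less_irrefl)
  define t where "t = max 1 e"
  have t: "1 \<le> t" "e \<le> t" by (auto simp: t_def)
  have "U (X \<omega> / (t * r)) \<le> (1 / t) * U (X \<omega> / r)" for \<omega>
    using C_function_scale_le[OF U, of "1 / t" "X \<omega> / r"] t by simp
  then have "(\<integral>\<^sup>+\<omega>. ennreal (U (X \<omega> / (t * r))) \<partial>M)
      \<le> (\<integral>\<^sup>+\<omega>. ennreal (1 / t) * ennreal (U (X \<omega> / r)) \<partial>M)"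
    using t by (intro nn_integral_mono)
      (simp add: C_function_nonneg[OF U] ennreal_leI flip: ennreal_mult)
  also have "\<dots> = ennreal (1 / t) * ennreal e"
    by (simp add: nn_integral_cmult e(1))
  also have "\<dots> = ennreal (e / t)" using t e(2) by (simp flip: ennreal_mult)
  also have "\<dots> \<le> 1" using t by simp
  finally have "(\<integral>\<^sup>+\<omega>. ennreal (U (X \<omega> / (t * r))) \<partial>M) \<le> 1" .
  moreover have "t * r > 0" using t r(1) by simp
  ultimately show ?thesis by blast
qed

lemma orlicz_norm_nonneg:
  assumes "C_function U" and "X \<in> orlicz_space U M"
  shows "0 \<le> orlicz_norm U M X"
  unfolding orlicz_norm_def
  by (rule cInf_greatest[OF orlicz_norm_set_nonempty[OF assms]]) auto

lemma nn_integral_le_1_of_orlicz_norm_less: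
  assumes U: "C_function U" and X: "X \<in> orlicz_space U M" and R: "orlicz_norm U M X < R"
  shows "(\<integral>\<^sup>+\<omega>. ennreal (U (X \<omega> / R)) \<partial>M) \<le> 1"
proof -
  obtain r where r: "r > 0" "(\<integral>\<^sup>+\<omega>. ennreal (U (X \<omega> / r)) \<partial>M) \<le> 1" "r < R"
    using cInf_lessD[OF orlicz_norm_set_nonempty[OF U X]] R unfolding orlicz_norm_def by blast
  have "(\<integral>\<^sup>+\<omega>. ennreal (U (X \<omega> / R)) \<partial>M) \<le> (\<integral>\<^sup>+\<omega>. ennreal (U (X \<omega> / r)) \<partial>M)"
    using r by (intro nn_integral_mono ennreal_leI C_function_mono_abs[OF U])
      (simp add: frac_le)
  then show ?thesis using r(2) by simp
qed

text \<open>Markov's inequality for \<open>U (X / R)\<close> at a scale \<open>R\<close> with \<open>E U(X / R) \<le> 1\<close>. The infimum in the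
  norm may be \<open>0\<close>, where division by it is meaningless, so the scales used are \<open>R = a / v\<close> with
  \<open>0 < v < u\<close>, which lie strictly above the norm; continuity of \<open>U\<close> then lets \<open>v\<close> tend to \<open>u\<close>.\<close>

lemma (in finite_measure) orlicz_chebyshev:
  assumes U: "C_function U" and X: "X \<in> orlicz_space U M"
    and a: "0 < a" and u: "0 < u" and le: "orlicz_norm U M X * u \<le> a"
  shows "measure M {\<omega> \<in> space M. \<bar>X \<omega>\<bar> > a} * U u \<le> 1"
proof -
  have mX: "X \<in> borel_measurable M" using X by (simp add: orlicz_space_def)
  note [measurable] = mX C_function_borel_measurable[OF U]
  define A where "A = {\<omega> \<in> space M. \<bar>X \<omega>\<bar> > a}"
  have A [measurable]: "A \<in> sets M" unfolding A_def by measurable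
  have markov: "measure M A * U v \<le> 1" if v: "0 < v" "v < u" for v
  proof -
    define R where "R = a / v"
    have "orlicz_norm U M X \<le> a / u" using le u by (simp add: field_simps)
    also have "\<dots> < R" unfolding R_def using a u v by (simp add: field_simps)
    finally have "(\<integral>\<^sup>+\<omega>. ennreal (U (X \<omega> / R)) \<partial>M) \<le> 1"
      by (rule nn_integral_le_1_of_orlicz_norm_less[OF U X])
    moreover have "ennreal (U v) * indicator A \<omega> \<le> ennreal (U (X \<omega> / R))" for \<omega>
    proof (cases "\<omega> \<in> A")
      case True
      have "U v \<le> U (X \<omega> / R)"
      proof (rule C_function_mono_abs[OF U])
        show "\<bar>v\<bar> \<le> \<bar>X \<omega> / R\<bar>"
          using True a v mult_strict_right_mono[of a "\<bar>X \<omega>\<bar>" v]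
          by (simp add: A_def R_def abs_mult pos_le_divide_eq mult.commute)
      qed
      then show ?thesis using True by (simp add: ennreal_leI)
    qed simp
    then have "(\<integral>\<^sup>+\<omega>. ennreal (U v) * indicator A \<omega> \<partial>M) \<le> (\<integral>\<^sup>+\<omega>. ennreal (U (X \<omega> / R)) \<partial>M)"
      by (intro nn_integral_mono)
    ultimately have "ennreal (U v) * emeasure M A \<le> 1"
      by (simp add: nn_integral_cmult_indicator)
    then have "ennreal (U v * measure M A) \<le> 1"
      by (simp add: emeasure_eq_measure ennreal_mult C_function_nonneg[OF U])
    then show ?thesis by (simp add: mult.commute)
  qed
  have "isCont U u"
    using U by (simp add: C_function_def continuous_on_eq_continuous_at)
  then have "((\<lambda>v. measure M A * U v) \<longlongrightarrow> measure M A * U u) (at_left u)"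
    by (intro tendsto_mult_left) (simp add: isCont_def filterlim_at_split)
  moreover have "eventually (\<lambda>v. measure M A * U v \<le> 1) (at_left u)"
    using eventually_at_left_real[OF u] by eventually_elim (auto intro: markov)
  ultimately show ?thesis
    unfolding A_def[symmetric] by (rule tendsto_upperbound) simp
qed

section \<open>Accuracy and reliability of the sample mean\<close>

text \<open>Condition H for the whole family bounds the square of the norm by \<open>n C N\<^sup>2\<close>. For \<open>C < 0\<close> the
  number \<open>sqrt C\<close> is negative and no bound could follow by taking roots; but then condition H for
  the single variable \<open>X 1\<close>, which reads \<open>N\<^sup>2 \<le> C N\<^sup>2\<close>, forces \<open>N = 0\<close>.\<close>

lemma condition_H_iid_norm_le:
  fixes C N :: real
  assumes U: "C_function U" and "prob_space M" and H: "condition_H U M C" and n: "n \<ge> 1"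
    and mem: "\<And>i. i \<in> {1..n} \<Longrightarrow> X i \<in> orlicz_space U M"
    and int: "\<And>i. i \<in> {1..n} \<Longrightarrow> integrable M (X i)"
    and centered: "\<And>i. i \<in> {1..n} \<Longrightarrow> (\<integral>\<omega>. X i \<omega> \<partial>M) = 0"
    and norm: "\<And>i. i \<in> {1..n} \<Longrightarrow> orlicz_norm U M (X i) = N"
    and indep: "prob_space.indep_vars M (\<lambda>_. borel) X {1..n}"
  shows "orlicz_norm U M (\<lambda>\<omega>. \<Sum>i=1..n. X i \<omega>) \<le> sqrt (real n) * (N * sqrt C)"
proof -
  interpret prob_space M by fact
  define T where "T = orlicz_norm U M (\<lambda>\<omega>. \<Sum>i=1..n. X i \<omega>)"
  have N: "0 \<le> N" using orlicz_norm_nonneg[OF U mem[of 1]] norm[of 1] n by simp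
  have H': "(orlicz_norm U M (\<lambda>\<omega>. \<Sum>k=1..m. X k \<omega>))\<^sup>2 \<le> C * (\<Sum>k=1..m. (orlicz_norm U M (X k))\<^sup>2)"
    if "m \<le> n" for m
  proof -
    have "indep_vars (\<lambda>_. borel) X {1..m}"
      by (rule indep_vars_subset[OF indep]) (use that in auto)
    moreover have "\<forall>k\<in>{1..m}. X k \<in> orlicz_space U M \<and> integrable M (X k) \<and> (\<integral>\<omega>. X k \<omega> \<partial>M) = 0"
      using mem int centered that by simp
    ultimately show ?thesis
      using H[unfolded condition_H_def, THEN spec[of _ m], THEN spec[of _ X]] by simp
  qed
  have T2: "T\<^sup>2 \<le> C * (real n * N\<^sup>2)"
    using H'[of n] norm unfolding T_def by simp
  have N2: "N\<^sup>2 \<le> C * N\<^sup>2"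
    using H'[of 1] norm[of 1] n by simp
  have N0: "N = 0" if "C < 0"
  proof (rule ccontr)
    assume "N \<noteq> 0"
    then have "0 < N\<^sup>2" by simp
    moreover from this have "C * N\<^sup>2 < 0" using that by (simp add: mult_neg_pos)
    ultimately show False using N2 by linarith
  qed
  have L: "0 \<le> N * sqrt C" using N N0 by (cases "C < 0") auto
  have "C * (real n * N\<^sup>2) = (sqrt (real n) * (N * sqrt C))\<^sup>2"
    using N0 by (cases "C < 0") (auto simp: power_mult_distrib)
  with T2 have "T\<^sup>2 \<le> (sqrt (real n) * (N * sqrt C))\<^sup>2" by (rule ord_le_eq_trans)
  then show ?thesis
    unfolding T_def by (rule power2_le_imp_le) (rule mult_nonneg_nonneg[OF _ L], simp)
qed

theorem theorem9p2:
  fixes \<mu> P :: "'s measure" and p f :: "'s \<Rightarrow> real" and I :: real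
    and \<Omega> :: "'w measure" and \<xi> :: "nat \<Rightarrow> 'w \<Rightarrow> real" and Z :: "'w \<Rightarrow> real"
    and U :: "real \<Rightarrow> real" and C L \<delta> \<epsilon> :: real and n :: nat
  assumes "sigma_finite_measure \<mu>"
    and "p \<in> borel_measurable \<mu>"
    and "\<And>s. s \<in> space \<mu> \<Longrightarrow> p s \<ge> 0"
    and "integrable \<mu> p"
    and "(\<integral>s. p s \<partial>\<mu>) = 1"
    and "P = density \<mu> (\<lambda>s. ennreal (p s))"
    and "f \<in> borel_measurable \<mu>"
    and "integrable \<mu> (\<lambda>s. f s * p s)"
    and "I = (\<integral>s. f s * p s \<partial>\<mu>)"
    and "C_function U"
    and "prob_space \<Omega>"
    and "n \<ge> 1"
    and "prob_space.indep_vars \<Omega> (\<lambda>_. borel) \<xi> {1..n}"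
    and "\<And>i. i \<in> {1..n} \<Longrightarrow> distr \<Omega> borel (\<xi> i) = distr P borel f"
    and "Z = (\<lambda>\<omega>. (1 / real n) * (\<Sum>i=1..n. \<xi> i \<omega>))"
    and "f \<in> orlicz_space U P"
    and "condition_H U \<Omega> C"
    and "L = orlicz_norm U P (\<lambda>s. f s - I) * sqrt C"
    and "0 < \<delta>" and "\<delta> < 1" and "\<epsilon> > 0"
    and "real n \<ge> (L * C_inverse U (1 / \<delta>) / \<epsilon>)\<^sup>2"
  shows "measure \<Omega> {\<omega> \<in> space \<Omega>. \<bar>Z \<omega> - I\<bar> > \<epsilon>} \<le> \<delta>"
proof -
  note p_meas = assms(2) and p_nonneg = assms(3) and P_def = assms(6) and f_meas = assms(7)
  note fp_int = assms(8) and U = assms(10) and n = assms(12) and law = assms(14)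
  interpret prob_space \<Omega> by fact
  interpret P: prob_space P
  proof
    have "emeasure P (space P) = (\<integral>\<^sup>+s. ennreal (p s) \<partial>\<mu>)"
      unfolding P_def using p_meas by (subst emeasure_density) (auto intro!: nn_integral_cong)
    also have "\<dots> = ennreal (\<integral>s. p s \<partial>\<mu>)"
      using assms(4) p_nonneg by (intro nn_integral_eq_integral) auto
    finally show "emeasure P (space P) = 1" using assms(5) by simp
  qed
  have f [measurable]: "f \<in> borel_measurable P" unfolding P_def using f_meas by simp
  have p_AE: "AE s in \<mu>. 0 \<le> p s" using p_nonneg by auto
  have f_int: "integrable P f"
    unfolding P_def using fp_int p_meas f_meas p_AE
    by (simp add: integrable_real_density mult.commute)
  have f_mean: "(\<integral>s. f s \<partial>P) = I"
    unfolding P_def assms(9) using p_meas f_meas p_AE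
    by (simp add: integral_real_density mult.commute)

  define X where "X i \<omega> = \<xi> i \<omega> - I" for i \<omega>
  define N where "N = orlicz_norm U P (\<lambda>s. f s - I)"
  define u where "u = C_inverse U (1 / \<delta>)"
  have \<xi>_meas: "\<xi> i \<in> borel_measurable \<Omega>" if "i \<in> {1..n}" for i
    using assms(13) that by (auto simp: indep_vars_def)
  have f_space: "(\<lambda>s. f s - I) \<in> orlicz_space U P"
    using orlicz_space_add[OF U assms(16) P.orlicz_space_const[of "- I"]] by simp

  \<comment> \<open>Space, norm and mean depend only on the law, so each \<open>X i\<close> inherits them from \<open>f - I\<close>.\<close>
  have X_space: "X i \<in> orlicz_space U \<Omega>" if i: "i \<in> {1..n}" for i
    using orlicz_space_distr[OF \<xi>_meas[OF i] _ U, of "\<lambda>x. x - I"]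
      orlicz_space_distr[OF f _ U, of "\<lambda>x. x - I"] f_space
    by (simp add: law[OF i] X_def[abs_def])
  have X_norm: "orlicz_norm U \<Omega> (X i) = N" if i: "i \<in> {1..n}" for i
    using orlicz_norm_distr[OF \<xi>_meas[OF i] _ U, of "\<lambda>x. x - I"]
      orlicz_norm_distr[OF f _ U, of "\<lambda>x. x - I"]
    by (simp add: law[OF i] X_def[abs_def] N_def)
  have \<xi>_int: "integrable \<Omega> (\<xi> i)" if i: "i \<in> {1..n}" for i
    using integrable_distr_eq[OF \<xi>_meas[OF i], of "\<lambda>x. x :: real"]
      integrable_distr_eq[OF f, of "\<lambda>x. x :: real"] f_int
    by (simp add: law[OF i])
  have \<xi>_mean: "(\<integral>\<omega>. \<xi> i \<omega> \<partial>\<Omega>) = I" if i: "i \<in> {1..n}" for i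
    using integral_distr[OF \<xi>_meas[OF i], of "\<lambda>x. x :: real"]
      integral_distr[OF f, of "\<lambda>x. x :: real"] f_mean
    by (simp add: law[OF i])
  have X_indep: "indep_vars (\<lambda>_. borel) X {1..n}"
    unfolding X_def[abs_def]
    by (rule indep_vars_compose2[OF assms(13), where Y = "\<lambda>_ x. x - I"]) auto
  have T_le: "orlicz_norm U \<Omega> (\<lambda>\<omega>. \<Sum>i=1..n. X i \<omega>) \<le> sqrt (real n) * L"
    using condition_H_iid_norm_le[OF U assms(11,17) n X_space _ _ X_norm X_indep] \<xi>_int \<xi>_mean
    by (simp add: X_def[abs_def] assms(18) N_def prob_space)

  have u_val: "U u = 1 / \<delta>" and u_nonneg: "0 \<le> u"
    unfolding u_def using C_inverse[OF U, of "1 / \<delta>"] assms(19) by auto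
  have u: "0 < u"
    using u_val u_nonneg U assms(19) by (cases "u = 0") (auto simp: C_function_def)
  have "L * u / \<epsilon> \<le> sqrt (real n)"
    using assms(22) by (intro real_le_rsqrt) (simp add: u_def)
  then have "L * u \<le> sqrt (real n) * \<epsilon>" using assms(21) by (simp add: field_simps)
  then have "sqrt (real n) * (L * u) \<le> sqrt (real n) * (sqrt (real n) * \<epsilon>)"
    by (intro mult_left_mono) auto
  then have "sqrt (real n) * L * u \<le> real n * \<epsilon>" by (simp flip: mult.assoc)
  moreover have "orlicz_norm U \<Omega> (\<lambda>\<omega>. \<Sum>i=1..n. X i \<omega>) * u \<le> sqrt (real n) * L * u"
    using T_le u by (intro mult_right_mono) auto
  ultimately have "orlicz_norm U \<Omega> (\<lambda>\<omega>. \<Sum>i=1..n. X i \<omega>) * u \<le> real n * \<epsilon>" by linarith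
  then have "measure \<Omega> {\<omega> \<in> space \<Omega>. \<bar>\<Sum>i=1..n. X i \<omega>\<bar> > real n * \<epsilon>} * U u \<le> 1"
    using n assms(21) u
    by (intro orlicz_chebyshev[OF U orlicz_space_sum[OF U X_space]]) auto
  moreover have "\<bar>Z \<omega> - I\<bar> > \<epsilon> \<longleftrightarrow> \<bar>\<Sum>i=1..n. X i \<omega>\<bar> > real n * \<epsilon>" for \<omega>
  proof -
    have "(\<Sum>i=1..n. X i \<omega>) = real n * (Z \<omega> - I)"
      using n by (simp add: X_def assms(15) sum_subtractf right_diff_distrib)
    then show ?thesis using n by (simp add: abs_mult)
  qed
  ultimately show ?thesis using assms(19) u_val by (simp add: field_simps)
qed

end
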